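(* Let $T$ be a tournament with $\chi'_{\mathrm{wo}}(T)=3$. Then $T$ admits a weak-odd 2-edge covering $\varphi$ in which at most one arc of $T$ is assigned both colors, i.e. $|\{a\in A(T):\varphi(a)=\{1,2\}\}|\le 1$.
   Context: A tournament is an orientation of a complete graph. For a vertex $v$ of a digraph $D$, the semi-cuts of $v$ are $\partial^+(v)$ (arcs leaving $v$) and $\partial^-(v)$ (arcs entering $v$). A map $\varphi:A(D)\to[k]=\{1,\dots,k\}$ satisfies condition (WO) at $v$ if there is a color $i\in[k]$ such that every nonempty semi-cut of $v$ contains an odd number of arcs of color $i$ (vacuous if both are empty); the weak-odd chromatic index $\chi'_{\mathrm{wo}}(D)$ is the least $k\ge0$ for which some $\varphi$ satisfies (WO) at every vertex. A 2-edge covering of $D$ is a map $\varphi$ assigning to each arc a nonempty subset of $\{1,2\}$; the color class of $i$ is $\{a\in A(D): i\in\varphi(a)\}$. It is a weak-odd 2-edge covering if for every vertex $v$ there is a color $i\in\{1,2\}$ such that every nonempty semi-cut of $v$ contains an odd number of arcs of the color class of $i$. *)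

theory Defs
  imports "Graph_Theory.Digraph" "HOL-Library.Extended_Nat"
begin

locale tournament = digraph T for T :: "('a, 'b) pre_digraph" +
  assumes one_orientation:
    "\<lbrakk>u \<in> verts T; v \<in> verts T; u \<noteq> v\<rbrakk> \<Longrightarrow> (u \<rightarrow>\<^bsub>T\<^esub> v) \<noteq> (v \<rightarrow>\<^bsub>T\<^esub> u)"

definition semi_cuts :: "('a, 'b) pre_digraph \<Rightarrow> 'a \<Rightarrow> 'b set set" where
  "semi_cuts D v = {out_arcs D v, in_arcs D v}"

text \<open>The premise makes the condition vacuous at isolated vertices; it only matters for \<open>k = 0\<close>,
  where there is no color to choose.\<close>

definition WO_at :: "('a, 'b) pre_digraph \<Rightarrow> nat \<Rightarrow> ('b \<Rightarrow> nat) \<Rightarrow> 'a \<Rightarrow> bool" where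
  "WO_at D k \<phi> v \<longleftrightarrow>
     (\<exists>S\<in>semi_cuts D v. S \<noteq> {}) \<longrightarrow>
     (\<exists>i\<in>{1..k}. \<forall>S\<in>semi_cuts D v. S \<noteq> {} \<longrightarrow> odd (card {a\<in>S. \<phi> a = i}))"

definition weak_odd_coloring :: "('a, 'b) pre_digraph \<Rightarrow> nat \<Rightarrow> ('b \<Rightarrow> nat) \<Rightarrow> bool" where
  "weak_odd_coloring D k \<phi> \<longleftrightarrow>
     (\<forall>a\<in>arcs D. \<phi> a \<in> {1..k}) \<and> (\<forall>v\<in>verts D. WO_at D k \<phi> v)"

text \<open>The index is \<open>\<infinity>\<close> if no weak-odd coloring exists.\<close>

definition weak_odd_chromatic_index :: "('a, 'b) pre_digraph \<Rightarrow> enat" where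
  "weak_odd_chromatic_index D = Inf {enat k | k. \<exists>\<phi>. weak_odd_coloring D k \<phi>}"

definition two_edge_covering :: "('a, 'b) pre_digraph \<Rightarrow> ('b \<Rightarrow> nat set) \<Rightarrow> bool" where
  "two_edge_covering D \<phi> \<longleftrightarrow> (\<forall>a\<in>arcs D. \<phi> a \<noteq> {} \<and> \<phi> a \<subseteq> {1, 2})"

definition color_class :: "('a, 'b) pre_digraph \<Rightarrow> ('b \<Rightarrow> nat set) \<Rightarrow> nat \<Rightarrow> 'b set" where
  "color_class D \<phi> i = {a\<in>arcs D. i \<in> \<phi> a}"

definition weak_odd_two_edge_covering :: "('a, 'b) pre_digraph \<Rightarrow> ('b \<Rightarrow> nat set) \<Rightarrow> bool" where
  "weak_odd_two_edge_covering D \<phi> \<longleftrightarrow>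
     two_edge_covering D \<phi> \<and>
     (\<forall>v\<in>verts D. \<exists>i\<in>{1, 2}. \<forall>S\<in>semi_cuts D v.
        S \<noteq> {} \<longrightarrow> odd (card (S \<inter> color_class D \<phi> i)))"

end

theory Submission
  imports Defs
begin

text \<open>
  Split every vertex \<open>v\<close> into an out-copy and an in-copy, so that arcs become edges of a bipartite
  graph and semi-cuts become stars. Prescribing which of the two colors serves each vertex turns
  the problem into finding an edge set with prescribed degree parities, which exists iff the set
  of odd vertices meets every union of components evenly.

  If the tournament has both a source and a sink, or neither, color 1 can serve all vertices.
  If there is a source \<open>s\<close> but no sink, the number of non-isolated copies is odd. Take an arc
  \<open>e\<close> from \<open>x \<noteq> s\<close> to \<open>y\<close>, and let color 2 serve \<open>y\<close> alone. As \<open>y\<close> has degree \<open>n - 1\<close>, this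
  repairs the parity for even \<open>n\<close>; for odd \<open>n\<close> it is repaired by giving \<open>e\<close> both colors.
  The remaining case follows by reversing all arcs.
\<close>

section \<open>Edge sets with prescribed degree parities\<close>

lemma even_card_sym_diff:
  assumes "finite A" "finite B"
  shows "even (card (sym_diff A B)) \<longleftrightarrow> (even (card A) \<longleftrightarrow> even (card B))"
proof -
  have "card (sym_diff A B) = card (A - B) + card (B - A)"
    using assms by (intro card_Un_disjoint) auto
  moreover have "card A = card (A \<inter> B) + card (A - B)"
    using assms(1) by (rule card_Int_Diff)
  moreover have "card B = card (B \<inter> A) + card (B - A)"
    using assms(2) by (rule card_Int_Diff)
  ultimately show ?thesis by (auto simp: Int_commute)
qed

text \<open>Think of \<open>e\<close> as an edge joining \<open>f e\<close> and \<open>g e\<close>;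
  the sets \<open>C\<close> in the hypothesis are the unions of components. Induction on
  \<open>A\<close>: if the hypothesis for \<open>U\<close> survives the loss of the new edge
  \<open>e\<close>, that edge is left out; otherwise it is put in, and the demands at its two ends
  are toggled, which gives \<open>U'\<close>.\<close>

lemma parity_join_exists:
  fixes f g :: "'b \<Rightarrow> 'c"
  assumes "finite A" "finite U"
    and "\<And>C. \<forall>e\<in>A. f e \<in> C \<longleftrightarrow> g e \<in> C \<Longrightarrow> even (card (U \<inter> C))"
  shows "\<exists>F\<subseteq>A. \<forall>c. odd (card {e\<in>F. f e = c} + card {e\<in>F. g e = c}) \<longleftrightarrow> c \<in> U"
  using assms
proof (induction A arbitrary: U rule: finite_induct)
  case empty
  have "c \<notin> U" for c
    \<comment> \<open>Without edges every singleton is closed, so \<open>U\<close> must be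
      empty.\<close>
    using empty.prems(2)[of "{c}"] by (cases "c \<in> U") auto
  then show ?case by auto
next
  case (insert e A)
  define U' where "U' = sym_diff (sym_diff U {f e}) {g e}"
  have fin': "finite U'" using insert.prems(1) by (simp add: U'_def)
  have U'_iff: "c \<in> U' \<longleftrightarrow> ((c \<in> U \<longleftrightarrow> c = f e) \<longleftrightarrow> c = g e)" for c
    by (auto simp: U'_def)
  have even_U': "even (card (U' \<inter> C)) \<longleftrightarrow>
      (even (card (U \<inter> C)) \<longleftrightarrow> (f e \<in> C \<longleftrightarrow> g e \<in> C))" for C
  proof -
    have "U' \<inter> C = sym_diff (sym_diff (U \<inter> C) ({f e} \<inter> C)) ({g e} \<inter> C)"
      by (auto simp: U'_def)
    then show ?thesis
      using insert.prems(1)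
      by (cases "f e \<in> C"; cases "g e \<in> C") (simp_all add: even_card_sym_diff)
  qed
  show ?case
  proof (cases "\<forall>C. (\<forall>e\<in>A. f e \<in> C \<longleftrightarrow> g e \<in> C) \<longrightarrow> even (card (U \<inter> C))")
    case True
    then obtain F where "F \<subseteq> A"
      "\<forall>c. odd (card {e\<in>F. f e = c} + card {e\<in>F. g e = c}) \<longleftrightarrow> c \<in> U"
      using insert.IH[OF insert.prems(1)] by blast
    then show ?thesis by blast
  next
    case False
    then obtain C where C: "\<forall>e\<in>A. f e \<in> C \<longleftrightarrow> g e \<in> C" "odd (card (U \<inter> C))"
      by blast
    then have C_e: "\<not> (f e \<in> C \<longleftrightarrow> g e \<in> C)"
      using insert.prems(2)[of C] by auto
    have "even (card (U' \<inter> D))" if D: "\<forall>e\<in>A. f e \<in> D \<longleftrightarrow> g e \<in> D" for D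
    proof (rule ccontr)
      assume odd: "odd (card (U' \<inter> D))"
      have D_e: "\<not> (f e \<in> D \<longleftrightarrow> g e \<in> D)"
        using insert.prems(2)[of D] D odd even_U'[of D] by auto
      \<comment> \<open>\<open>C\<close> and \<open>D\<close> both separate the ends of
        \<open>e\<close>, so their symmetric difference does not; it is closed for the larger edge
        set.\<close>
      have "\<forall>e'\<in>insert e A. f e' \<in> sym_diff C D \<longleftrightarrow> g e' \<in> sym_diff C D"
        using C C_e D D_e by auto
      then have "even (card (U \<inter> sym_diff C D))"
        by (rule insert.prems(2))
      moreover have "U \<inter> sym_diff C D = sym_diff (U \<inter> C) (U \<inter> D)" by auto
      ultimately have "odd (card (U \<inter> D))"
        using C insert.prems(1) by (simp add: even_card_sym_diff)
      then show False
        using odd D_e even_U'[of D] by auto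
    qed
    then obtain F where F: "F \<subseteq> A"
      "\<forall>c. odd (card {e\<in>F. f e = c} + card {e\<in>F. g e = c}) \<longleftrightarrow> c \<in> U'"
      using insert.IH[OF fin'] by blast
    have "finite F" "e \<notin> F"
      using F(1) insert.hyps by (auto dest: finite_subset)
    have card_insert: "card {e'\<in>insert e F. h e' = c} =
        (if h e = c then 1 else 0) + card {e'\<in>F. h e' = c}" for h :: "'b \<Rightarrow> 'c" and c
    proof -
      have "{e'\<in>insert e F. h e' = c} =
          (if h e = c then insert e {e'\<in>F. h e' = c} else {e'\<in>F. h e' = c})"
        by auto
      then show ?thesis using \<open>finite F\<close> \<open>e \<notin> F\<close> by simp
    qed
    have "odd (card {e'\<in>insert e F. f e' = c} + card {e'\<in>insert e F. g e' = c}) \<longleftrightarrow> c \<in> U" for c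
      using F(2)[rule_format, of c] U'_iff[of c] unfolding card_insert by auto
    then show ?thesis
      using F(1) by (intro exI[of _ "insert e F"]) blast
  qed
qed

text \<open>The previous result on the bipartite double: \<open>Inl v\<close> is the out-copy and
  \<open>Inr v\<close> the in-copy of \<open>v\<close>. A closed set splits into its traces
  \<open>P\<close> and \<open>R\<close> on the two sides.\<close>

lemma (in fin_digraph) semi_cut_parity_join_exists:
  assumes "A \<subseteq> arcs G" "finite U" "finite W"
    and even: "\<And>P R. \<forall>e\<in>A. tail G e \<in> P \<longleftrightarrow> head G e \<in> R \<Longrightarrow>
      even (card (U \<inter> P) + card (W \<inter> R))"
  obtains F where "F \<subseteq> A"
    "\<And>v. odd (card (out_arcs G v \<inter> F)) \<longleftrightarrow> v \<in> U"
    "\<And>v. odd (card (in_arcs G v \<inter> F)) \<longleftrightarrow> v \<in> W"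
proof -
  have "finite A" using assms(1) finite_arcs finite_subset by blast
  moreover have "even (card ((U <+> W) \<inter> C))"
    if "\<forall>e\<in>A. Inl (tail G e) \<in> C \<longleftrightarrow> Inr (head G e) \<in> C" for C
  proof -
    have "(U <+> W) \<inter> C = (U \<inter> Inl -` C) <+> (W \<inter> Inr -` C)" by auto
    then show ?thesis
      using even[of "Inl -` C" "Inr -` C"] that assms(2,3) by (simp add: card_Plus)
  qed
  ultimately obtain F where F: "F \<subseteq> A"
    "\<forall>c. odd (card {e\<in>F. Inl (tail G e) = c} + card {e\<in>F. Inr (head G e) = c}) \<longleftrightarrow> c \<in> U <+> W"
    using parity_join_exists[of A "U <+> W" "Inl \<circ> tail G" "Inr \<circ> head G"] assms(2,3)
    by auto
  have "out_arcs G v \<inter> F = {e\<in>F. tail G e = v}" "in_arcs G v \<inter> F = {e\<in>F. head G e = v}" for v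
    using F(1) assms(1) by auto
  then show thesis
    using F(2)[rule_format, of "Inl _"] F(2)[rule_format, of "Inr _"]
    by (intro that[OF F(1)]) auto
qed

section \<open>Coverings of tournaments\<close>

text \<open>\<open>S\<close> is the set of vertices served by color 2, and \<open>F \<union> X\<close> is the class of color 1.\<close>

lemma (in fin_digraph) weak_odd_covering_of_join:
  assumes "X \<subseteq> arcs G" "F \<subseteq> arcs G - X"
    and color1: "\<And>v K. v \<in> verts G - S \<Longrightarrow> K \<in> semi_cuts G v \<Longrightarrow> K \<noteq> {} \<Longrightarrow>
      odd (card (K \<inter> F) + card (K \<inter> X))"
    and color2: "\<And>v K. v \<in> S \<Longrightarrow> K \<in> semi_cuts G v \<Longrightarrow> K \<noteq> {} \<Longrightarrow>
      odd (card K + card (K \<inter> F))"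
  shows "\<exists>\<phi>. weak_odd_two_edge_covering G \<phi> \<and> {a \<in> arcs G. \<phi> a = {1, 2}} = X"
proof -
  define \<phi> :: "'b \<Rightarrow> nat set" where
    "\<phi> a = (if a \<in> X then {1, 2} else if a \<in> F then {1} else {2})" for a
  \<comment> \<open>Since \<open>F\<close> avoids \<open>X\<close>, the doubly colored arcs lie in
    \<open>arcs G - F\<close> as well.\<close>
  have classes: "color_class G \<phi> 1 = F \<union> X" "color_class G \<phi> 2 = arcs G - F"
    using assms(1,2) by (auto simp: color_class_def \<phi>_def split: if_splits)
  have doubles: "{a \<in> arcs G. \<phi> a = {1, 2}} = X"
    using assms(1) by (auto simp: \<phi>_def split: if_splits)
  have "\<exists>i\<in>{1, 2}. \<forall>K\<in>semi_cuts G v. K \<noteq> {} \<longrightarrow> odd (card (K \<inter> color_class G \<phi> i))"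
    if v: "v \<in> verts G" for v
  proof (cases "v \<in> S")
    case True
    have "odd (card (K \<inter> color_class G \<phi> 2))" if K: "K \<in> semi_cuts G v" "K \<noteq> {}" for K
    proof -
      have "K \<subseteq> arcs G" "finite K"
        using K(1) by (auto simp: semi_cuts_def)
      then have "K \<inter> color_class G \<phi> 2 = K - F"
        unfolding classes by auto
      moreover have "card K = card (K \<inter> F) + card (K - F)"
        using \<open>finite K\<close> by (rule card_Int_Diff)
      ultimately show ?thesis using color2[OF True K] by presburger
    qed
    then show ?thesis by blast
  next
    case False
    have "odd (card (K \<inter> color_class G \<phi> 1))" if K: "K \<in> semi_cuts G v" "K \<noteq> {}" for K
    proof -
      have "finite K"
        using K(1) by (auto simp: semi_cuts_def)
      then have "card (K \<inter> color_class G \<phi> 1) = card (K \<inter> F) + card (K \<inter> X)"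
        unfolding classes Int_Un_distrib using assms(2) by (intro card_Un_disjoint) auto
      then show ?thesis using color1[OF _ K] v False by simp
    qed
    then show ?thesis by blast
  qed
  moreover have "two_edge_covering G \<phi>"
    by (auto simp: two_edge_covering_def \<phi>_def)
  ultimately show ?thesis
    using doubles unfolding weak_odd_two_edge_covering_def by blast
qed

section \<open>Arcs and degrees in a tournament\<close>

context tournament
begin

lemma arc_between:
  assumes "u \<in> verts T" "v \<in> verts T" "u \<noteq> v"
  shows "\<exists>e\<in>arcs T. tail T e = u \<and> head T e = v \<or> tail T e = v \<and> head T e = u"
  using one_orientation[OF assms] by (auto simp: arcs_ends_conv)

lemma arc_from_source:
  assumes "s \<in> verts T" "in_arcs T s = {}" "v \<in> verts T" "v \<noteq> s"
  shows "\<exists>e\<in>arcs T. tail T e = s \<and> head T e = v"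
  using assms arc_between[of s v] by auto

lemma arc_to_sink:
  assumes "t \<in> verts T" "out_arcs T t = {}" "v \<in> verts T" "v \<noteq> t"
  shows "\<exists>e\<in>arcs T. tail T e = v \<and> head T e = t"
  using assms arc_between[of t v] by auto

text \<open>The heads of the out-arcs and the tails of the in-arcs of \<open>v\<close> partition the
  other vertices. This ties the parities of the two semi-cuts to that of the order.\<close>

lemma card_out_arcs_plus_card_in_arcs:
  assumes "v \<in> verts T"
  shows "card (out_arcs T v) + card (in_arcs T v) + 1 = card (verts T)"
proof -
  let ?H = "head T ` out_arcs T v" and ?L = "tail T ` in_arcs T v"
  have "inj_on (head T) (out_arcs T v)" "inj_on (tail T) (in_arcs T v)"
    by (auto intro!: inj_onI no_multi_arcs simp: arc_to_ends_def)
  then have cards: "card ?H = card (out_arcs T v)" "card ?L = card (in_arcs T v)"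
    by (simp_all add: card_image)
  have "?H \<inter> ?L = {}"
  proof (rule ccontr)
    assume "?H \<inter> ?L \<noteq> {}"
    then obtain a b where ab: "a \<in> arcs T" "b \<in> arcs T" "tail T a = v" "head T b = v"
      "head T a = tail T b" by fastforce
    then have "(v, head T a) \<in> arcs_ends T" "(head T a, v) \<in> arcs_ends T"
      by (auto simp: arcs_ends_conv image_iff)
    then show False
      using one_orientation[of v "head T a"] ab no_loops[of a] assms by auto
  qed
  moreover have "?H \<union> ?L = verts T - {v}"
  proof
    show "?H \<union> ?L \<subseteq> verts T - {v}"
      using no_loops by fastforce
    show "verts T - {v} \<subseteq> ?H \<union> ?L"
    proof
      fix w assume "w \<in> verts T - {v}"
      then show "w \<in> ?H \<union> ?L"
        using assms arc_between[of v w] by (force simp: image_iff)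
    qed
  qed
  ultimately have "card (verts T - {v}) = card (out_arcs T v) + card (in_arcs T v)"
    using cards card_Un_disjoint[of ?H ?L] finite_in_arcs[of v] finite_out_arcs[of v] by simp
  then show ?thesis
    using assms card_Suc_Diff1[of "verts T" v] by simp
qed

section \<open>Closed sets of the bipartite double\<close>

text \<open>Sort the vertices by membership in \<open>P\<close> and in \<open>R\<close>. Those in
  both sets count twice, so it suffices that \<open>P - R\<close> and \<open>R - P\<close> have
  equally many vertices. Each has at most one, and neither occurs without the other.\<close>

lemma even_closed_of_no_source_no_sink:
  assumes no_source: "\<And>v. v \<in> verts T \<Longrightarrow> in_arcs T v \<noteq> {}"
    and no_sink: "\<And>v. v \<in> verts T \<Longrightarrow> out_arcs T v \<noteq> {}"
    and closed: "\<forall>e\<in>arcs T. tail T e \<in> P \<longleftrightarrow> head T e \<in> R"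
  shows "even (card (verts T \<inter> P) + card (verts T \<inter> R))"
proof -
  let ?V = "verts T"
  \<comment> \<open>No arc joins two vertices of \<open>P - R\<close>, nor does one join \<open>P \<inter> R\<close> to the complement of
    \<open>P \<union> R\<close>.\<close>
  have diff_unique: "u = v"
    if "u \<in> ?V" "v \<in> ?V" "u \<in> P \<longleftrightarrow> v \<in> P" "u \<in> R \<longleftrightarrow> v \<in> R" "u \<in> P \<longleftrightarrow> u \<notin> R" for u v
    using that closed arc_between[of u v] by blast
  have one_empty: "?V \<inter> P \<inter> R = {} \<or> ?V - P - R = {}"
  proof (rule ccontr)
    assume "\<not> ?thesis"
    then obtain u v where "u \<in> ?V" "v \<in> ?V" "u \<in> P" "u \<in> R" "v \<notin> P" "v \<notin> R" by auto
    then show False using closed arc_between[of u v] by blast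
  qed
  have nbr: "\<exists>w\<in>?V. w \<in> R \<longleftrightarrow> v \<in> P" "\<exists>w\<in>?V. w \<in> P \<longleftrightarrow> v \<in> R" if v: "v \<in> ?V" for v
  proof -
    obtain a b where "a \<in> arcs T" "tail T a = v" "b \<in> arcs T" "head T b = v"
      using no_source[OF v] no_sink[OF v] by fastforce
    then show "\<exists>w\<in>?V. w \<in> R \<longleftrightarrow> v \<in> P" "\<exists>w\<in>?V. w \<in> P \<longleftrightarrow> v \<in> R"
      using closed by force+
  qed
  \<comment> \<open>An out-neighbor of \<open>a\<close> lies in \<open>R\<close> and an in-neighbor
    lies outside \<open>P\<close>. If neither were in \<open>R - P\<close>, the first would lie in
    both sets and the second in none, against \<open>one_empty\<close>.\<close>
  have PR: "?V \<inter> R - P \<noteq> {}" if "a \<in> ?V \<inter> P - R" for a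
    using that one_empty nbr[of a] by blast
  have RP: "?V \<inter> P - R \<noteq> {}" if "b \<in> ?V \<inter> R - P" for b
    using that one_empty nbr[of b] by blast
  have "card (?V \<inter> P - R) = card (?V \<inter> R - P)"
  proof (cases "?V \<inter> P - R = {}")
    case True
    then have "?V \<inter> R - P = {}" using RP by blast
    with True show ?thesis by (metis card.empty)
  next
    case False
    then obtain a b where ab: "a \<in> ?V \<inter> P - R" "b \<in> ?V \<inter> R - P" using PR by blast
    have "v = a" if "v \<in> ?V \<inter> P - R" for v
      using diff_unique[of v a] that ab by auto
    moreover have "v = b" if "v \<in> ?V \<inter> R - P" for v
      using diff_unique[of v b] that ab by auto
    ultimately have "?V \<inter> P - R = {a}" "?V \<inter> R - P = {b}" using ab by blast+
    then show ?thesis by simp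
  qed
  moreover have "card (?V \<inter> P) = card (?V \<inter> P \<inter> R) + card (?V \<inter> P - R)"
    by (rule card_Int_Diff) simp
  moreover have "card (?V \<inter> R) = card (?V \<inter> R \<inter> P) + card (?V \<inter> R - P)"
    by (rule card_Int_Diff) simp
  moreover have "?V \<inter> R \<inter> P = ?V \<inter> P \<inter> R" by auto
  ultimately show ?thesis by simp
qed

text \<open>All non-isolated copies form one component: \<open>s\<close> is joined to every other
  in-copy, and every out-copy but that of \<open>t\<close> is joined to the in-copy of
  \<open>t\<close>. A closed set thus contains all of these copies or none, and each side has one
  less than the number of vertices.\<close>

lemma even_closed_of_source_and_sink:
  assumes s: "s \<in> verts T" "in_arcs T s = {}" and t: "t \<in> verts T" "out_arcs T t = {}"
    and closed: "\<forall>e\<in>arcs T. tail T e \<in> P \<longleftrightarrow> head T e \<in> R"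
  shows "even (card ((verts T - {t}) \<inter> P) + card ((verts T - {s}) \<inter> R))"
proof -
  have in_R: "v \<in> R \<longleftrightarrow> s \<in> P" if "v \<in> verts T - {s}" for v
    using that closed arc_from_source[OF s, of v] by auto
  have in_P: "v \<in> P \<longleftrightarrow> s \<in> P" if v: "v \<in> verts T - {t}" for v
  proof -
    obtain e where e: "e \<in> arcs T" "tail T e = v" "head T e = t"
      using v arc_to_sink[OF t, of v] by blast
    then have "t \<noteq> s" using s by auto
    then show ?thesis using e in_R[of t] t closed by blast
  qed
  show ?thesis
  proof (cases "s \<in> P")
    case True
    then have "(verts T - {t}) \<inter> P = verts T - {t}" "(verts T - {s}) \<inter> R = verts T - {s}"
      using in_P in_R by auto
    then show ?thesis using s t by simp
  next
    case False
    then have "(verts T - {t}) \<inter> P = {}" "(verts T - {s}) \<inter> R = {}"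
      using in_P in_R by auto
    then show ?thesis by simp
  qed
qed

section \<open>Coverings from parity joins\<close>

text \<open>Color 1 serves every vertex: \<open>U\<close> and \<open>W\<close> ask for odd degree at
  exactly the copies whose semi-cut is nonempty.\<close>

lemma covering_of_odd_join:
  fixes U W :: "'a set"
  defines "U \<equiv> {v \<in> verts T. out_arcs T v \<noteq> {}}" and "W \<equiv> {v \<in> verts T. in_arcs T v \<noteq> {}}"
  assumes "\<And>P R. \<forall>e\<in>arcs T. tail T e \<in> P \<longleftrightarrow> head T e \<in> R \<Longrightarrow>
      even (card (U \<inter> P) + card (W \<inter> R))"
  shows "\<exists>\<phi>. weak_odd_two_edge_covering T \<phi> \<and> {a \<in> arcs T. \<phi> a = {1, 2}} = {}"
proof -
  obtain F where F: "F \<subseteq> arcs T"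
    "\<And>v. odd (card (out_arcs T v \<inter> F)) \<longleftrightarrow> v \<in> U"
    "\<And>v. odd (card (in_arcs T v \<inter> F)) \<longleftrightarrow> v \<in> W"
    using semi_cut_parity_join_exists[of "arcs T" U W] assms by auto
  show ?thesis
  proof (rule weak_odd_covering_of_join[where F = F and S = "{}"])
    fix v K assume vK: "v \<in> verts T - {}" "K \<in> semi_cuts T v" "K \<noteq> {}"
    then show "odd (card (K \<inter> F) + card (K \<inter> {}))"
      using F(2,3)[of v] by (auto simp: semi_cuts_def U_def W_def)
  qed (use F in auto)
qed

lemma covering_of_source_no_sink:
  assumes s: "s \<in> verts T" "in_arcs T s = {}"
    and no_sink: "\<And>v. v \<in> verts T \<Longrightarrow> out_arcs T v \<noteq> {}"
  shows "\<exists>\<phi>. weak_odd_two_edge_covering T \<phi> \<and> card {a \<in> arcs T. \<phi> a = {1, 2}} \<le> 1"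
proof -
  have head_s: "head T a \<noteq> s" if "a \<in> arcs T" for a
    using that s by auto
  have out_arc: "\<exists>a\<in>arcs T. tail T a = v" if "v \<in> verts T" for v
    using no_sink[OF that] by (auto simp: out_arcs_def)
  \<comment> \<open>The head of any arc differs from \<open>s\<close> and is not a sink, so it can
    serve as the tail of \<open>e\<close>.\<close>
  obtain a where a: "a \<in> arcs T" using out_arc[OF s(1)] by blast
  obtain e where "e \<in> arcs T" "tail T e = head T a"
    using out_arc[OF head_in_verts[OF a]] by blast
  then have e: "e \<in> arcs T" "tail T e \<noteq> s" using head_s[OF a] by simp_all
  define x y where "x = tail T e" and "y = head T e"
  have xy: "x \<in> verts T" "y \<in> verts T" "x \<noteq> s" "y \<noteq> s" "x \<noteq> y"
    using e no_loops[of e] head_s[of e] by (auto simp: x_def y_def)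
  define n where "n = card (verts T)"
  define X where "X = (if even n then {} else {e})"
  \<comment> \<open>If \<open>e\<close> has both colors, it already gives \<open>x\<close> one arc
    of color 1, so \<open>F\<close> must be even at the out-copy of \<open>x\<close>. At
    \<open>y\<close> the complement of \<open>F\<close> must be odd, so \<open>F\<close> gets the
    parity opposite to the size of the semi-cut.\<close>
  define U where
    "U = verts T - (if even n then {} else {x}) - (if even (card (out_arcs T y)) then {} else {y})"
  define W where
    "W = verts T - {s} - (if even (card (in_arcs T y)) then {} else {y})"
  have "even (card U + card W)"
  proof -
    define p q where "p = card (out_arcs T y)" and "q = card (in_arcs T y)"
    \<comment> \<open>Three distinct vertices keep the subtractions below from being cut off at
      zero.\<close>
    have "card {s, x, y} \<le> n"
      unfolding n_def using s xy by (intro card_mono) auto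
    then have "3 \<le> n" using xy by simp
    moreover have "card U = n - of_bool (odd n) - of_bool (odd p)"
      using xy by (simp add: U_def n_def p_def)
    moreover have "card W = n - 1 - of_bool (odd q)"
      using xy s by (simp add: W_def n_def q_def)
    moreover have "n = p + q + 1"
      using card_out_arcs_plus_card_in_arcs[OF xy(2)] by (simp add: n_def p_def q_def)
    ultimately show ?thesis
      by (cases "even p"; cases "even q") (auto dest: odd_pos)
  qed
  have "even (card (U \<inter> P) + card (W \<inter> R))"
    if closed: "\<forall>e\<in>arcs T - X. tail T e \<in> P \<longleftrightarrow> head T e \<in> R" for P R
  proof -
    have in_R: "v \<in> R \<longleftrightarrow> s \<in> P" if v: "v \<in> verts T" "v \<noteq> s" for v
    proof -
      obtain a where a: "a \<in> arcs T" "tail T a = s" "head T a = v"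
        using arc_from_source[OF s v] by blast
      \<comment> \<open>\<open>e\<close> does not leave \<open>s\<close>, so removing it keeps all
        arcs of the source.\<close>
      then have "a \<in> arcs T - X" using e by (auto simp: X_def)
      then show ?thesis using closed a by auto
    qed
    have in_P: "v \<in> P \<longleftrightarrow> s \<in> P" if v: "v \<in> U" for v
    proof -
      obtain a where a: "a \<in> arcs T" "tail T a = v"
        using out_arc[of v] v by (auto simp: U_def)
      \<comment> \<open>When \<open>e\<close> is removed, its tail \<open>x\<close> is not in
        \<open>U\<close>; so \<open>a\<close> differs from \<open>e\<close>.\<close>
      then have "a \<in> arcs T - X" using v by (auto simp: X_def U_def x_def split: if_splits)
      then show ?thesis using closed a in_R[of "head T a"] head_s[of a] by auto
    qed
    have in_R': "v \<in> R \<longleftrightarrow> s \<in> P" if "v \<in> W" for v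
      using that by (intro in_R) (auto simp: W_def)
    show ?thesis
    proof (cases "s \<in> P")
      case True
      then have "U \<inter> P = U" "W \<inter> R = W" using in_P in_R' by auto
      then show ?thesis using \<open>even (card U + card W)\<close> by simp
    next
      case False
      then have "U \<inter> P = {}" "W \<inter> R = {}" using in_P in_R' by auto
      then show ?thesis by simp
    qed
  qed
  moreover have "finite U" "finite W" by (simp_all add: U_def W_def)
  ultimately obtain F where F: "F \<subseteq> arcs T - X"
    "\<And>v. odd (card (out_arcs T v \<inter> F)) \<longleftrightarrow> v \<in> U"
    "\<And>v. odd (card (in_arcs T v \<inter> F)) \<longleftrightarrow> v \<in> W"
    using semi_cut_parity_join_exists[of "arcs T - X" U W] by blast
  have "\<exists>\<phi>. weak_odd_two_edge_covering T \<phi> \<and> {a \<in> arcs T. \<phi> a = {1, 2}} = X"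
  proof (rule weak_odd_covering_of_join[where F = F and S = "{y}"])
    show "X \<subseteq> arcs T" using e by (simp add: X_def)
    show "F \<subseteq> arcs T - X" by fact
  next
    fix v K assume v: "v \<in> verts T - {y}" and K: "K \<in> semi_cuts T v" "K \<noteq> {}"
    have out_X: "out_arcs T v \<inter> X = (if v = x \<and> odd n then {e} else {})"
      using e by (auto simp: X_def x_def)
    \<comment> \<open>The only arc that can be in \<open>X\<close> enters \<open>y\<close>, which
      color 2 serves.\<close>
    have in_X: "in_arcs T v \<inter> X = {}"
      using v by (auto simp: X_def y_def)
    from K(1) consider "K = out_arcs T v" | "K = in_arcs T v"
      by (auto simp: semi_cuts_def)
    then show "odd (card (K \<inter> F) + card (K \<inter> X))"
    proof cases
      case 1
      then show ?thesis using F(2)[of v] v by (auto simp: out_X U_def)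
    next
      case 2
      then have "v \<noteq> s" using K s by auto
      then show ?thesis using 2 F(3)[of v] v by (auto simp: in_X W_def)
    qed
  next
    fix v K assume "v \<in> {y}" "K \<in> semi_cuts T v" "K \<noteq> {}"
    then show "odd (card K + card (K \<inter> F))"
      using F(2)[of y] F(3)[of y] xy by (auto simp: semi_cuts_def U_def W_def split: if_splits)
  qed
  moreover have "card X \<le> 1" by (simp add: X_def)
  ultimately show ?thesis by metis
qed

end

section \<open>Reversal of all arcs\<close>

definition reverse_digraph :: "('a, 'b) pre_digraph \<Rightarrow> ('a, 'b) pre_digraph" where
  "reverse_digraph D = D\<lparr>tail := head D, head := tail D\<rparr>"

lemma reverse_digraph_simps [simp]:
  "verts (reverse_digraph D) = verts D" "arcs (reverse_digraph D) = arcs D"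
  "tail (reverse_digraph D) = head D" "head (reverse_digraph D) = tail D"
  by (simp_all add: reverse_digraph_def)

lemma semi_cut_reverse_digraph [simp]:
  "out_arcs (reverse_digraph D) v = in_arcs D v" "in_arcs (reverse_digraph D) v = out_arcs D v"
  by (auto simp: out_arcs_def in_arcs_def)

lemma (in tournament) tournament_reverse_digraph: "tournament (reverse_digraph T)"
proof
  fix u v assume "u \<in> verts (reverse_digraph T)" "v \<in> verts (reverse_digraph T)" "u \<noteq> v"
  moreover have "(a, b) \<in> arcs_ends (reverse_digraph T) \<longleftrightarrow> (b, a) \<in> arcs_ends T" for a b
    by (auto simp: arcs_ends_conv image_iff)
  ultimately show "(u \<rightarrow>\<^bsub>reverse_digraph T\<^esub> v) \<noteq> (v \<rightarrow>\<^bsub>reverse_digraph T\<^esub> u)"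
    using one_orientation[of v u] by simp
next
  fix e assume "e \<in> arcs (reverse_digraph T)"
  then show "tail (reverse_digraph T) e \<noteq> head (reverse_digraph T) e"
    using no_loops[of e] by simp
next
  fix e1 e2
  assume "e1 \<in> arcs (reverse_digraph T)" "e2 \<in> arcs (reverse_digraph T)"
    "arc_to_ends (reverse_digraph T) e1 = arc_to_ends (reverse_digraph T) e2"
  then show "e1 = e2"
    by (intro no_multi_arcs) (simp_all add: arc_to_ends_def)
qed simp_all

text \<open>Reversal only exchanges the two semi-cuts of each vertex, and (WO) treats them
  alike.\<close>

lemma weak_odd_two_edge_covering_reverse_digraph [simp]:
  "weak_odd_two_edge_covering (reverse_digraph D) \<phi> \<longleftrightarrow> weak_odd_two_edge_covering D \<phi>"
proof -
  have "semi_cuts (reverse_digraph D) v = semi_cuts D v" for v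
    by (auto simp: semi_cuts_def)
  then show ?thesis
    by (simp add: weak_odd_two_edge_covering_def two_edge_covering_def color_class_def)
qed

text \<open>Reversal makes the sink a source and leaves the set of doubly colored arcs
  unchanged.\<close>

lemma (in tournament) covering_of_sink_no_source:
  assumes "t \<in> verts T" "out_arcs T t = {}"
    and "\<And>v. v \<in> verts T \<Longrightarrow> in_arcs T v \<noteq> {}"
  shows "\<exists>\<phi>. weak_odd_two_edge_covering T \<phi> \<and> card {a \<in> arcs T. \<phi> a = {1, 2}} \<le> 1"
  using tournament.covering_of_source_no_sink[OF tournament_reverse_digraph, of t] assms
  by simp

theorem theorem5p2:
  fixes T :: "('a, 'b) pre_digraph"
  assumes "tournament T"
    and "weak_odd_chromatic_index T = 3"
  shows "\<exists>\<phi>. weak_odd_two_edge_covering T \<phi> \<and> card {a \<in> arcs T. \<phi> a = {1, 2}} \<le> 1"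
proof -
  interpret tournament T by fact
  let ?U = "{v \<in> verts T. out_arcs T v \<noteq> {}}" and ?W = "{v \<in> verts T. in_arcs T v \<noteq> {}}"
  consider (none) "\<And>v. v \<in> verts T \<Longrightarrow> in_arcs T v \<noteq> {}" "\<And>v. v \<in> verts T \<Longrightarrow> out_arcs T v \<noteq> {}"
    | (both) s t where "s \<in> verts T" "in_arcs T s = {}" "t \<in> verts T" "out_arcs T t = {}"
    | (source) s where "s \<in> verts T" "in_arcs T s = {}" "\<And>v. v \<in> verts T \<Longrightarrow> out_arcs T v \<noteq> {}"
    | (sink) t where "t \<in> verts T" "out_arcs T t = {}" "\<And>v. v \<in> verts T \<Longrightarrow> in_arcs T v \<noteq> {}"
    by metis
  then show ?thesis
  proof cases
    case none
    then have UW: "?U = verts T" "?W = verts T" by auto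
    have "\<exists>\<phi>. weak_odd_two_edge_covering T \<phi> \<and> {a \<in> arcs T. \<phi> a = {1, 2}} = {}"
      by (rule covering_of_odd_join)
        (unfold UW, rule even_closed_of_no_source_no_sink[OF none])
    then show ?thesis by (metis card.empty zero_le_one)
  next
    case both
    \<comment> \<open>Every other vertex sends an arc to \<open>t\<close> and, likewise, every
      vertex but \<open>s\<close> receives one from \<open>s\<close>; so only these two can have an
      empty semi-cut.\<close>
    have "?U = verts T - {t}"
      using both(4) arc_to_sink[OF both(3,4)] by fastforce
    moreover have "?W = verts T - {s}"
      using both(2) arc_from_source[OF both(1,2)] by fastforce
    ultimately have UW: "?U = verts T - {t}" "?W = verts T - {s}" .
    have "\<exists>\<phi>. weak_odd_two_edge_covering T \<phi> \<and> {a \<in> arcs T. \<phi> a = {1, 2}} = {}"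
      by (rule covering_of_odd_join)
        (unfold UW, rule even_closed_of_source_and_sink[OF both])
    then show ?thesis by (metis card.empty zero_le_one)
  next
    case source
    then show ?thesis by (rule covering_of_source_no_sink)
  next
    case sink
    then show ?thesis by (rule covering_of_sink_no_source)
  qed
qed

end
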